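(* For $x\in[1,2]$ and $y=(y_1,y_2)\in\mathbb R^2$ let $$h_1(x,y)=y_1^2+y_2^2-1,\qquad h_2(x,y)=y_1^2+\Big(\frac{y_2}{x}\Big)^2-\frac12,$$ and let $\mathcal Y(x)=\{y\in\mathbb R^2: h_1(x,y)\le 0,\ h_2(x,y)\le 0\}$. There exist a compact set $K\subset\mathbb R^2$ with $\mathcal Y(x)\subset\operatorname{int}(K)$ for all $x\in[1,2]$ and $\epsilon>0$ such that the following holds: for any $C^2$ functions $r_1,r_2:[1,2]\times\mathbb R^2\to\mathbb R$ with $$|r_i(x,y)|\le\epsilon,\quad \|\nabla_y r_i(x,y)\|\le\epsilon,\quad \|\nabla^2_{yy}r_i(x,y)\|_{\rm op}\le\epsilon\qquad\text{for all }x\in[1,2],\ y\in K,\ i=1,2,$$ and $\widetilde h_i=h_i+r_i$, there exist $x^\ast\in[1,2]$ and a point $y^\ast\in\mathbb R^2$ feasible for the perturbed constraints at $x^\ast$ (i.e. $\widetilde h_i(x^\ast,y^\ast)\le 0$ for $i=1,2$) such that LICQ for the perturbed constraints fails at $(x^\ast,y^\ast)$.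
   Context: LICQ for constraints $\widetilde h_i(x,y)\le 0$ holds at a feasible point $(x,y)$ if the vectors $\{\nabla_y\widetilde h_i(x,y): \widetilde h_i(x,y)=0\}$ are linearly independent; otherwise it fails at $(x,y)$. *)

theory Defs
  imports "HOL-Analysis.Analysis"
begin

definition h :: "nat \<Rightarrow> real \<Rightarrow> real^2 \<Rightarrow> real" where
  "h i x y = (if i = 1 then (y $ 1)^2 + (y $ 2)^2 - 1
              else (y $ 1)^2 + (y $ 2 / x)^2 - 1/2)"

definition feasible :: "(nat \<Rightarrow> real \<Rightarrow> real^2 \<Rightarrow> real) \<Rightarrow> real \<Rightarrow> (real^2) set" where
  "feasible g x = {y. \<forall>i\<in>{1, 2}. g i x y \<le> 0}"

text \<open>On a convex set with nonempty interior, such as \<open>{1..2} \<times> UNIV\<close>, derivatives within the set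
  are unique; at the endpoints of \<open>{1..2}\<close> they are one-sided in the first variable.\<close>

definition C2_on :: "'a::real_normed_vector set \<Rightarrow> ('a \<Rightarrow> 'b::real_normed_vector) \<Rightarrow> bool" where
  "C2_on S f \<longleftrightarrow>
    (\<exists>(f' :: 'a \<Rightarrow> 'a \<Rightarrow>\<^sub>L 'b) (f'' :: 'a \<Rightarrow> 'a \<Rightarrow>\<^sub>L ('a \<Rightarrow>\<^sub>L 'b)).
      (\<forall>z\<in>S. (f has_derivative blinfun_apply (f' z)) (at z within S)) \<and>
      (\<forall>z\<in>S. (f' has_derivative blinfun_apply (f'' z)) (at z within S)) \<and>
      continuous_on S f'')"

definition grad_y :: "(real \<Rightarrow> real^2 \<Rightarrow> real) \<Rightarrow> real \<Rightarrow> real^2 \<Rightarrow> real^2" where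
  "grad_y f x y = (THE D. GDERIV (f x) y :> D)"

text \<open>The Hessian in \<open>y\<close>, as a linear map: the derivative of the gradient.\<close>

definition hess_y :: "(real \<Rightarrow> real^2 \<Rightarrow> real) \<Rightarrow> real \<Rightarrow> real^2 \<Rightarrow> (real^2 \<Rightarrow> real^2)" where
  "hess_y f x y = frechet_derivative (grad_y f x) (at y)"

text \<open>The active gradients are a family indexed by the active constraints: two active constraints
  with the same gradient violate LICQ, hence the injectivity.\<close>

definition LICQ :: "(nat \<Rightarrow> real \<Rightarrow> real^2 \<Rightarrow> real) \<Rightarrow> real \<Rightarrow> real^2 \<Rightarrow> bool" where
  "LICQ g x y \<longleftrightarrow>
    (let A = {i\<in>{1, 2}. g i x y = 0}
     in inj_on (\<lambda>i. grad_y (g i) x y) A \<and> independent ((\<lambda>i. grad_y (g i) x y) ` A))"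

end

theory Submission
  imports Defs
begin

text \<open>Call \<open>y\<close> an escape point at \<open>x\<close> if \<open>g 2 x y \<le> 0 \<le> g 1 x y\<close>, where \<open>g\<close> is the perturbed
  constraint family. At \<open>x = 1\<close> there is none, because the ellipse lies well inside the unit disk,
  while at \<open>x = 2\<close> there is one. Take the smallest \<open>x\<close> that has an escape point. If LICQ held there,
  some direction would increase \<open>g 1\<close> and decrease \<open>g 2\<close> wherever they vanish; after a small step both
  inequalities would be strict and would persist for a slightly smaller \<open>x\<close>, a contradiction.
  The escape point is feasible, i.e. \<open>g 1\<close> vanishes there, because otherwise decreasing \<open>g 2\<close> alone
  would suffice: its gradient is nonzero on its zero set by \<open>y \<bullet> \<nabla>h\<^sub>2 = 2 h\<^sub>2 + 1\<close>.\<close>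

section \<open>Gradients in \<open>y\<close> and what C2 regularity on a strip provides\<close>

lemma grad_y_eqI:
  assumes "GDERIV (f x) y :> D"
  shows "grad_y f x y = D"
  unfolding grad_y_def using assms
proof (rule the_equality)
  fix D' assume "GDERIV (f x) y :> D'"
  then have "(\<lambda>k. k \<bullet> D') = (\<lambda>k. k \<bullet> D)"
    using assms unfolding gderiv_def by (rule has_derivative_unique)
  then show "D' = D"
    by (subst vector_eq_ldot[symmetric]) (simp add: fun_eq_iff)
qed

text \<open>Riesz representation: the adjoint of the derivative, applied to 1, is the vector whose
  inner product with any direction is the directional derivative.\<close>

lemma GDERIV_grad_y:
  assumes "f x differentiable (at y)"
  shows "GDERIV (f x) y :> grad_y f x y"
proof -
  obtain f' where f': "(f x has_derivative f') (at y)"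
    using assms by (auto simp: differentiable_def)
  then interpret linear f'
    by (rule has_derivative_linear)
  have "f' k = k \<bullet> adjoint f' 1" for k
    using adjoint_works[OF linear_axioms, of k 1] by simp
  then have "f' = (\<lambda>k. k \<bullet> adjoint f' 1)"
    by (rule ext)
  from back_subst[of "\<lambda>f'. (f x has_derivative f') (at y)", OF f' this]
  have "GDERIV (f x) y :> adjoint f' 1"
    unfolding gderiv_def .
  moreover from this have "grad_y f x y = adjoint f' 1"
    by (rule grad_y_eqI)
  ultimately show ?thesis
    by simp
qed

lemma C2_onE:
  assumes "C2_on S f" and "z \<in> S"
  obtains f' where "(f has_derivative f') (at z within S)"
proof -
  obtain f' where "\<forall>z\<in>S. (f has_derivative blinfun_apply (f' z)) (at z within S)"
    using assms(1) unfolding C2_on_def by (elim exE conjE)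
  then show ?thesis
    using bspec[OF _ assms(2)] that by blast
qed

lemma C2_on_imp_continuous_on:
  assumes "C2_on S f"
  shows "continuous_on S f"
  unfolding continuous_on_eq_continuous_within
  by (intro ballI) (rule C2_onE[OF assms], assumption, rule has_derivative_continuous)

text \<open>The joint derivative is only taken within the strip, but the whole slice over
  \<open>x\<close> lies in the strip. Composing with \<open>Pair x\<close> therefore gives an
  unrestricted derivative in \<open>y\<close>, even when \<open>x\<close> is an endpoint of an
  interval.\<close>

lemma C2_on_imp_differentiable_snd:
  assumes "C2_on (X \<times> UNIV) (\<lambda>(x, y). f x y)" and "x \<in> X"
  shows "f x differentiable (at y)"
proof -
  from assms have "(x, y) \<in> X \<times> UNIV"
    by simp
  from C2_onE[OF assms(1) this]
  obtain f' where f': "((\<lambda>(x, y). f x y) has_derivative f') (at (x, y) within X \<times> UNIV)" .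
  have "((\<lambda>y. (x, y)) has_derivative (\<lambda>k. (0, k))) (at y)"
    by (intro has_derivative_Pair has_derivative_const has_derivative_ident)
  moreover have "((\<lambda>(x, y). f x y) has_derivative f') (at (x, y) within range (Pair x))"
    by (rule has_derivative_subset[OF f']) (use assms(2) in auto)
  ultimately have "((\<lambda>(x, y). f x y) \<circ> Pair x has_derivative f' \<circ> (\<lambda>k. (0, k))) (at y)"
    by (rule diff_chain_within)
  then have "(f x has_derivative f' \<circ> (\<lambda>k. (0, k))) (at y)"
    by (simp add: comp_def)
  then show ?thesis
    by (rule differentiableI)
qed

section \<open>Directions along which the constraints separate\<close>

text \<open>If both constraints are active, their gradients are not parallel, so Cauchy-Schwarz is
  strict and the difference of the normalised gradients works. If at most one is active, its
  gradient or the negative of it works, since the other requirement is vacuous.\<close>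

lemma LICQ_imp_separating_direction:
  assumes "LICQ g x y"
  shows "\<exists>d. (g 1 x y = 0 \<longrightarrow> d \<bullet> grad_y (g 1) x y > 0) \<and>
             (g 2 x y = 0 \<longrightarrow> d \<bullet> grad_y (g 2) x y < 0)"
proof -
  define a b where "a = grad_y (g 1) x y" and "b = grad_y (g 2) x y"
  define A where "A = {i \<in> {1, 2}. g i x y = 0}"
  have inj: "inj_on (\<lambda>i. grad_y (g i) x y) A" and ind: "independent ((\<lambda>i. grad_y (g i) x y) ` A)"
    using assms by (simp_all add: LICQ_def A_def Let_def)
  have a0: "a \<noteq> 0" if "g 1 x y = 0"
  proof -
    have "a \<in> (\<lambda>i. grad_y (g i) x y) ` A"
      unfolding a_def using that by (intro imageI) (simp add: A_def)
    with ind show ?thesis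
      by (metis dependent_zero)
  qed
  have b0: "b \<noteq> 0" if "g 2 x y = 0"
  proof -
    have "b \<in> (\<lambda>i. grad_y (g i) x y) ` A"
      unfolding b_def using that by (intro imageI) (simp add: A_def)
    with ind show ?thesis
      by (metis dependent_zero)
  qed
  show ?thesis
  proof (cases "g 1 x y = 0 \<and> g 2 x y = 0")
    case True
    then have A: "A = {1, 2}"
      by (auto simp: A_def)
    have "a \<noteq> b"
      using inj by (auto simp: A a_def b_def)
    moreover have "independent {a, b}"
      using ind by (simp add: A a_def b_def)
    ultimately have "a \<notin> span {b}"
      by (simp add: independent_insert)
    moreover have "a \<in> span {b}" if "norm a *\<^sub>R b = norm b *\<^sub>R a"
    proof -
      have "norm b *\<^sub>R a \<in> span {b}"
        unfolding that[symmetric] by (intro span_scale span_base) simp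
      then have "(1 / norm b) *\<^sub>R norm b *\<^sub>R a \<in> span {b}"
        by (rule span_scale)
      then show ?thesis
        using b0 True by simp
    qed
    ultimately have "a \<bullet> b \<noteq> norm a * norm b"
      using norm_cauchy_schwarz_eq[of a b] by blast
    then have less: "a \<bullet> b < norm a * norm b"
      using norm_cauchy_schwarz[of a b] by simp
    \<comment> \<open>This is the difference of the unit vectors of \<open>a\<close> and
      \<open>b\<close>, multiplied by \<open>norm a * norm b\<close> to avoid division. Both inner
      products contain the Cauchy-Schwarz gap as a factor.\<close>
    define d where "d = norm b *\<^sub>R a - norm a *\<^sub>R b"
    have "d \<bullet> a = norm a * (norm a * norm b - a \<bullet> b)"
      by (simp add: d_def inner_diff_left dot_square_norm power2_eq_square inner_commute[of b] algebra_simps)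
    moreover have "d \<bullet> b = - (norm b * (norm a * norm b - a \<bullet> b))"
      by (simp add: d_def inner_diff_left dot_square_norm power2_eq_square algebra_simps)
    ultimately have "d \<bullet> a > 0" "d \<bullet> b < 0"
      using less mult_pos_pos[of _ "norm a * norm b - a \<bullet> b"] a0 b0 True by simp_all
    then show ?thesis
      unfolding a_def b_def by blast
  next
    case False
    then consider "g 2 x y \<noteq> 0" | "g 1 x y \<noteq> 0"
      by blast
    then show ?thesis
    proof cases
      case 1
      then show ?thesis
        using a0 by (intro exI[of _ a]) (auto simp: a_def)
    next
      case 2
      then show ?thesis
        using b0 by (intro exI[of _ "- b"]) (auto simp: b_def)
    qed
  qed
qed

text \<open>Where \<open>f y\<close> is positive, continuity preserves the sign for small steps in
  any direction; where it is zero, the positive directional derivative makes it positive.\<close>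

lemma eventually_greater_along_direction:
  fixes f :: "'a::real_inner \<Rightarrow> real"
  assumes D: "GDERIV f y :> D" and "f y \<ge> 0" and "f y = 0 \<Longrightarrow> d \<bullet> D > 0"
  shows "\<forall>\<^sub>F t in at_right 0. f (y + t *\<^sub>R d) > 0"
proof -
  have "((\<lambda>t. f (y + t *\<^sub>R d)) has_derivative (\<lambda>t. (t *\<^sub>R d) \<bullet> D)) (at 0)"
    using D unfolding gderiv_def
    by (intro has_derivative_compose[of "\<lambda>t. y + t *\<^sub>R d" _ _ _ f])
       (auto intro!: derivative_eq_intros)
  then have der: "((\<lambda>t. f (y + t *\<^sub>R d)) has_real_derivative (d \<bullet> D)) (at 0)"
    unfolding has_field_derivative_def by (simp add: mult.commute[of _ "d \<bullet> D"])
  show ?thesis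
  proof (cases "f y = 0")
    case True
    from has_real_derivative_pos_inc_right[of _ _ 0 UNIV, simplified, OF der] assms(3)[OF True]
    obtain e where "e > 0" "\<And>k. k > 0 \<Longrightarrow> k < e \<Longrightarrow> f (y + k *\<^sub>R d) > 0"
      using True by auto
    then show ?thesis
      by (auto simp: eventually_at_right_field)
  next
    case False
    have "((\<lambda>t. f (y + t *\<^sub>R d)) \<longlongrightarrow> f y) (at_right 0)"
      using DERIV_isCont[OF der] by (auto simp: isCont_def intro: tendsto_mono[OF at_within_le_at])
    then show ?thesis
      using False assms(2) by (auto dest: order_tendstoD(1)[of _ _ _ 0])
  qed
qed

section \<open>The first parameter with an escape point\<close>

text \<open>Compactness of \<open>K\<close> makes the smallest parameter attained. The assumption
  \<open>inner\<close> keeps small steps away from an escape point within \<open>K\<close>, and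
  \<open>descent\<close> supplies a direction decreasing \<open>g 2\<close> without appeal to
  LICQ.\<close>

lemma first_contact_violates_LICQ:
  fixes g :: "nat \<Rightarrow> real \<Rightarrow> real^2 \<Rightarrow> real"
  assumes "compact K" and "a \<le> b"
    and cont: "\<And>i. i \<in> {1, 2} \<Longrightarrow> continuous_on ({a..b} \<times> UNIV) (\<lambda>(x, y). g i x y)"
    and diff: "\<And>i x y. i \<in> {1, 2} \<Longrightarrow> x \<in> {a..b} \<Longrightarrow> g i x differentiable (at y)"
    and no_contact: "\<And>y. y \<in> K \<Longrightarrow> g 2 a y \<le> 0 \<Longrightarrow> g 1 a y < 0"
    and contact: "\<exists>y\<in>K. g 2 b y \<le> 0 \<and> 0 \<le> g 1 b y"
    and inner: "\<And>x y. x \<in> {a..b} \<Longrightarrow> y \<in> K \<Longrightarrow> g 2 x y \<le> 0 \<Longrightarrow> y \<in> interior K"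
    and descent: "\<And>x y. x \<in> {a..b} \<Longrightarrow> y \<in> K \<Longrightarrow> g 2 x y = 0 \<Longrightarrow> grad_y (g 2) x y \<noteq> 0"
  shows "\<exists>x\<in>{a..b}. \<exists>y\<in>feasible g x. \<not> LICQ g x y"
proof -
  define S where "S = {z \<in> {a..b} \<times> K. g 2 (fst z) (snd z) \<le> 0 \<and> 0 \<le> g 1 (fst z) (snd z)}"
  have contK: "continuous_on ({a..b} \<times> K) (\<lambda>z. g i (fst z) (snd z))" if "i \<in> {1, 2}" for i
    using continuous_on_subset[OF cont[OF that], of "{a..b} \<times> K"] by (simp add: case_prod_unfold Sigma_mono)
  have "compact ({a..b} \<times> K)"
    using \<open>compact K\<close> by (intro compact_Times) auto
  moreover have "closed S"
  proof -
    have "closed ({a..b} \<times> K)"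
      using \<open>compact K\<close> by (intro closed_Times) (auto intro: compact_imp_closed)
    \<comment> \<open>Continuity is available only on the closed product, so the two inequalities
      are imposed in turn, each cutting a closed set out of a closed set.\<close>
    then have "closed {z \<in> {z \<in> {a..b} \<times> K. g 2 (fst z) (snd z) \<le> 0}. 0 \<le> g 1 (fst z) (snd z)}"
      using contK[of 1] contK[of 2]
      by (intro continuous_on_closed_Collect_le continuous_on_const) (auto elim: continuous_on_subset)
    then show ?thesis
      by (rule back_subst[of closed]) (auto simp: S_def)
  qed
  ultimately have "compact S"
    using compact_Int_closed[of "{a..b} \<times> K" S] by (simp add: S_def Int_absorb1 subset_iff)
  moreover have "S \<noteq> {}"
    using contact \<open>a \<le> b\<close> by (force simp: S_def)
  ultimately obtain z where "z \<in> S" and z: "\<And>w. w \<in> S \<Longrightarrow> fst z \<le> fst w"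
    using continuous_attains_inf[of S fst] continuous_on_fst[OF continuous_on_id] by blast
  define x y where "x = fst z" and "y = snd z"
  have x: "x \<in> {a..b}" and y: "y \<in> K" and g2: "g 2 x y \<le> 0" and g1: "0 \<le> g 1 x y"
    using \<open>z \<in> S\<close> by (auto simp: S_def x_def y_def)
  have first: False if "x' \<in> {a<..<x}" "y' \<in> K" "g 2 x' y' \<le> 0" "0 \<le> g 1 x' y'" for x' y'
    using z[of "(x', y')"] that x by (auto simp: S_def x_def)
  have "a < x"
    using no_contact[OF y] g1 g2 x by (cases "x = a") auto
  have GD: "GDERIV (g i x) y :> grad_y (g i) x y" if "i \<in> {1, 2}" for i
    using GDERIV_grad_y diff[OF that x] by blast
  have no_direction: False
    if d1: "g 1 x y = 0 \<Longrightarrow> d \<bullet> grad_y (g 1) x y > 0"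
      and d2: "g 2 x y = 0 \<Longrightarrow> d \<bullet> grad_y (g 2) x y < 0" for d
  proof -
    have "GDERIV (\<lambda>y. - g 2 x y) y :> - grad_y (g 2) x y"
      using GD[of 2] by (auto intro: GDERIV_minus)
    then have "\<forall>\<^sub>F t in at_right 0. - g 2 x (y + t *\<^sub>R d) > 0"
      using g2 d2 by (intro eventually_greater_along_direction[where f = "\<lambda>y. - g 2 x y"]) auto
    moreover have "\<forall>\<^sub>F t in at_right 0. g 1 x (y + t *\<^sub>R d) > 0"
      using g1 d1 GD[of 1] by (intro eventually_greater_along_direction[where f = "g 1 x"]) auto
    moreover have "\<forall>\<^sub>F t in at_right 0. y + t *\<^sub>R d \<in> interior K"
    proof (rule topological_tendstoD)
      show "((\<lambda>t. y + t *\<^sub>R d) \<longlongrightarrow> y) (at_right 0)"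
        by (auto intro!: tendsto_eq_intros)
    qed (use inner[OF x y g2] in auto)
    ultimately have "\<forall>\<^sub>F t in at_right (0::real). \<exists>y'\<in>K. g 2 x y' < 0 \<and> g 1 x y' > 0"
      by eventually_elim (use interior_subset in force)
    then obtain y' where y': "y' \<in> K" "g 2 x y' < 0" "g 1 x y' > 0"
      by (auto simp: eventually_const_iff trivial_limit_at_right_real)
    \<comment> \<open>Continuity in the parameter holds only within \<open>{a..b}\<close>. Since
      \<open>a < x\<close>, there is room on the left, and a left limit is all that minimality of
      \<open>x\<close> calls for.\<close>
    have lim: "((\<lambda>x. g i x y') \<longlongrightarrow> g i x y') (at_left x)" if "i \<in> {1, 2}" for i
    proof -
      have "continuous_on {a..b} (\<lambda>x. g i x y')"
        using continuous_on_compose2[OF cont[OF that], of "{a..b}" "\<lambda>x. (x, y')"]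
        by (simp add: continuous_on_Pair image_subset_iff)
      then have "((\<lambda>x. g i x y') \<longlongrightarrow> g i x y') (at x within {a..b})"
        using x by (auto simp: continuous_on_def)
      then have "((\<lambda>x. g i x y') \<longlongrightarrow> g i x y') (at x within {a..x})"
        by (rule tendsto_within_subset) (use x in auto)
      then show ?thesis
        using \<open>a < x\<close> by (simp add: at_within_Icc_at_left)
    qed
    have "\<forall>\<^sub>F x' in at_left x. x' \<in> {a<..<x} \<and> g 2 x' y' < 0 \<and> g 1 x' y' > 0"
      using order_tendstoD(2)[OF lim[of 2] y'(2)] order_tendstoD(1)[OF lim[of 1] y'(3)]
        eventually_at_left_real[OF \<open>a < x\<close>]
      by (intro eventually_conj) simp_all
    then obtain x' where "x' \<in> {a<..<x}" "g 2 x' y' < 0" "g 1 x' y' > 0"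
      using eventually_happens'[OF trivial_limit_at_left_real] by blast
    then show False
      using first[of x' y'] y'(1) by auto
  qed
  have "g 1 x y = 0"
  proof (rule ccontr)
    assume "g 1 x y \<noteq> 0"
    \<comment> \<open>With \<open>g 1\<close> nonzero, its requirement on the direction is vacuous,
      and steepest descent for \<open>g 2\<close> meets the other one.\<close>
    then show False
      using no_direction[of "- grad_y (g 2) x y"] descent[OF x y] by auto
  qed
  then have "y \<in> feasible g x"
    using g2 by (simp add: feasible_def)
  moreover have "\<not> LICQ g x y"
  proof
    assume "LICQ g x y"
    from LICQ_imp_separating_direction[OF this] show False
      using no_direction by metis
  qed
  ultimately show ?thesis
    using x by blast
qed

section \<open>Estimates for the disk and the ellipses\<close>

text \<open>Euler's identity for \<open>h 2 x + 1/2\<close>, a homogeneous quadratic form in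
  \<open>y\<close>.\<close>

lemma inner_h_2_gradient_self:
  assumes "GDERIV (h 2 x) y :> D"
  shows "y \<bullet> D = 2 * h 2 x y + 1"
proof -
  have nth: "((\<lambda>y :: real^2. y $ k) has_derivative (\<lambda>v. v $ k)) (at y)" for k
    by (intro bounded_linear_imp_has_derivative bounded_linear_vec_nth)
  have "(h 2 x has_derivative (\<lambda>v. 2 * v $ 1 * y $ 1 + 2 * (v $ 2 / x) * (y $ 2 / x))) (at y)"
    unfolding h_def divide_inverse[of _ x] by (auto intro!: derivative_eq_intros nth)
  with assms have "(\<lambda>v. v \<bullet> D) = (\<lambda>v. 2 * v $ 1 * y $ 1 + 2 * (v $ 2 / x) * (y $ 2 / x))"
    unfolding gderiv_def by (rule has_derivative_unique)
  then have "y \<bullet> D = 2 * y $ 1 * y $ 1 + 2 * (y $ 2 / x) * (y $ 2 / x)"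
    by (rule fun_cong)
  also have "\<dots> = 2 * h 2 x y + 1"
    by (simp add: h_def power2_eq_square)
  finally show ?thesis .
qed

theorem mainTheorem4:
  "\<exists>(K :: (real^2) set) (\<epsilon> :: real).
     compact K \<and> (\<forall>x\<in>{1..2}. feasible h x \<subseteq> interior K) \<and> \<epsilon> > 0 \<and>
     (\<forall>r :: nat \<Rightarrow> real \<Rightarrow> real^2 \<Rightarrow> real.
        (\<forall>i\<in>{1, 2}. C2_on ({1..2} \<times> UNIV) (\<lambda>(x, y). r i x y)) \<and>
        (\<forall>i\<in>{1, 2}. \<forall>x\<in>{1..2}. \<forall>y\<in>K.
           \<bar>r i x y\<bar> \<le> \<epsilon> \<and> norm (grad_y (r i) x y) \<le> \<epsilon> \<and> onorm (hess_y (r i) x y) \<le> \<epsilon>) \<longrightarrow>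
        (\<exists>x\<in>{1..2}. \<exists>y\<in>feasible (\<lambda>i x y. h i x y + r i x y) x.
           \<not> LICQ (\<lambda>i x y. h i x y + r i x y) x y))"
proof -
  have norm2: "(norm y)\<^sup>2 = (y $ 1)\<^sup>2 + (y $ 2)\<^sup>2" for y :: "real^2"
    by (simp add: power2_norm_eq_inner inner_vec_def sum_2) (simp add: power2_eq_square)
  have in_ball: "y \<in> ball 0 2" if "(y $ 1)\<^sup>2 + (y $ 2)\<^sup>2 < 4" for y :: "real^2"
    using that power2_less_imp_less[of "norm y" 2] by (simp add: norm2)
  \<comment> \<open>Here \<open>h 1\<close> already confines \<open>y\<close> to the unit disk. The
    radius 2 leaves room for the perturbed ellipses, which leave that disk as \<open>x\<close>
    grows.\<close>
  have feas: "feasible h x \<subseteq> interior (cball 0 2)" for x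
    by (auto simp: feasible_def h_def interior_cball intro!: in_ball)
  have perturbed: "\<exists>x\<in>{1..2}. \<exists>y\<in>feasible (\<lambda>i x y. h i x y + r i x y) x.
      \<not> LICQ (\<lambda>i x y. h i x y + r i x y) x y"
    if C2: "\<And>i. i \<in> {1, 2} \<Longrightarrow> C2_on ({1..2} \<times> UNIV) (\<lambda>(x, y). r i x y)"
      and small: "\<And>i x y. i \<in> {1, 2} \<Longrightarrow> x \<in> {1..2} \<Longrightarrow> y \<in> cball 0 2 \<Longrightarrow>
        \<bar>r i x y\<bar> \<le> 1/10 \<and> norm (grad_y (r i) x y) \<le> 1/10"
    for r :: "nat \<Rightarrow> real \<Rightarrow> real^2 \<Rightarrow> real"
  proof (rule first_contact_violates_LICQ[where K = "cball 0 2"])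
    have diff_h: "h i x differentiable (at y)" for i x y
    proof -
      have "(\<lambda>y :: real^2. y $ k) differentiable (at y)" for k
        by (intro bounded_linear_imp_differentiable bounded_linear_vec_nth)
      then show ?thesis
        unfolding h_def divide_inverse by (cases "i = 1") (simp_all add: power2_eq_square)
    qed
    have diff_r: "r i x differentiable (at y)" if "i \<in> {1, 2}" "x \<in> {1..2}" for i x y
      by (rule C2_on_imp_differentiable_snd[OF C2]) (use that in auto)
    show "(\<lambda>y. h i x y + r i x y) differentiable (at y)" if "i \<in> {1, 2}" "x \<in> {1..2}" for i x y
      using diff_h diff_r[OF that] by (intro differentiable_add) (simp_all add: eta_contract_eq)
    show "continuous_on ({1..2} \<times> UNIV) (\<lambda>(x, y). h i x y + r i x y)" if "i \<in> {1, 2}" for i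
    proof -
      have "continuous_on ({1..2} \<times> UNIV) (\<lambda>z. h i (fst z) (snd z))"
        unfolding h_def by (cases "i = 1") (auto intro!: continuous_intros)
      then show ?thesis
        using C2_on_imp_continuous_on[OF C2[OF that]]
        by (auto simp: case_prod_unfold intro: continuous_on_add)
    qed
    \<comment> \<open>At \<open>x = 1\<close> the functions satisfy
      \<open>h 1 1 y = h 2 1 y - 1/2\<close>, so the perturbed value is at most -1/2 + 2/10.\<close>
    show "h 1 1 y + r 1 1 y < 0" if "y \<in> cball 0 2" "h 2 1 y + r 2 1 y \<le> 0" for y
      using small[of 1 1 y] small[of 2 1 y] that by (auto simp: h_def abs_le_iff)
    show "\<exists>y\<in>cball 0 2. h 2 2 y + r 2 2 y \<le> 0 \<and> 0 \<le> h 1 2 y + r 1 2 y"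
    proof
      \<comment> \<open>On the long axis of the ellipse at \<open>x = 2\<close>, this point has
        \<open>h 2 2 y = -7/50\<close> and \<open>h 1 2 y = 11/25\<close>; both signs withstand an
        error of 1/10.\<close>
      define y :: "real^2" where "y = vector [0, 6/5]"
      have y: "y $ 1 = 0" "y $ 2 = 6/5"
        by (simp_all add: y_def)
      show "y \<in> cball 0 2"
        using in_ball[of y] by (simp add: y power2_eq_square)
      then show "h 2 2 y + r 2 2 y \<le> 0 \<and> 0 \<le> h 1 2 y + r 1 2 y"
        using small[of 1 2 y] small[of 2 2 y] by (auto simp: h_def y power2_eq_square abs_le_iff)
    qed
    show "y \<in> interior (cball 0 2)"
      if "x \<in> {1..2}" "y \<in> cball 0 2" "h 2 x y + r 2 x y \<le> 0" for x y
    proof -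
      \<comment> \<open>As \<open>x\<close> is at most 2, the squared norm of \<open>y\<close> is at
        most 4 times \<open>h 2 x y + 1/2\<close>, hence at most 4 * (1/2 + 1/10) < 4.\<close>
      have "(y $ 2)\<^sup>2 = x\<^sup>2 * (y $ 2 / x)\<^sup>2"
        using that(1) by (simp add: power_divide)
      also have "\<dots> \<le> 4 * (y $ 2 / x)\<^sup>2"
        using that(1) power_mono[of x 2 2] by (intro mult_right_mono) auto
      finally have "(y $ 1)\<^sup>2 + (y $ 2)\<^sup>2 \<le> 4 * ((y $ 1)\<^sup>2 + (y $ 2 / x)\<^sup>2)"
        unfolding distrib_left by (intro add_mono) simp_all
      also have "\<dots> < 4"
        using small[of 2 x y] that by (auto simp: h_def abs_le_iff)
      finally show ?thesis
        by (simp only: interior_cball in_ball)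
    qed
    show "grad_y (\<lambda>x y. h 2 x y + r 2 x y) x y \<noteq> 0"
      if x: "x \<in> {1..2}" and y: "y \<in> cball 0 2" and active: "h 2 x y + r 2 x y = 0" for x y
    proof
      have gh: "GDERIV (h 2 x) y :> grad_y (h 2) x y" and gr: "GDERIV (r 2 x) y :> grad_y (r 2) x y"
        using x by (auto intro!: GDERIV_grad_y diff_h diff_r)
      assume "grad_y (\<lambda>x y. h 2 x y + r 2 x y) x y = 0"
      then have "y \<bullet> grad_y (h 2) x y + y \<bullet> grad_y (r 2) x y = 0"
        using grad_y_eqI[where f = "\<lambda>x y. h 2 x y + r 2 x y", OF GDERIV_add[OF gh gr]]
        by (simp flip: inner_add_right)
      \<comment> \<open>On the zero set Euler's identity gives
        \<open>y \<bullet> grad_y (h 2) x y = 1 - 2 * r 2 x y\<close>, at least 4/5, which a term of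
        size at most 1/5 cannot cancel.\<close>
      moreover have "\<bar>y \<bullet> grad_y (r 2) x y\<bar> \<le> 2 * (1/10)"
        using small[of 2 x y] x y
        by (intro order_trans[OF Cauchy_Schwarz_ineq2] mult_mono) auto
      ultimately show False
        using inner_h_2_gradient_self[OF gh] small[of 2 x y] x y active by (auto simp: abs_le_iff)
    qed
  qed auto
  show ?thesis
  proof (intro exI conjI ballI allI impI)
    show "compact (cball (0 :: real^2) 2)"
      by (rule compact_cball)
    show "feasible h x \<subseteq> interior (cball 0 2)" for x
      by (rule feas)
    show "(0 :: real) < 1/10"
      by simp
  next
    fix r :: "nat \<Rightarrow> real \<Rightarrow> real^2 \<Rightarrow> real"
    assume r: "(\<forall>i\<in>{1, 2}. C2_on ({1..2} \<times> UNIV) (\<lambda>(x, y). r i x y)) \<and>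
      (\<forall>i\<in>{1, 2}. \<forall>x\<in>{1..2}. \<forall>y\<in>cball 0 2.
        \<bar>r i x y\<bar> \<le> 1/10 \<and> norm (grad_y (r i) x y) \<le> 1/10 \<and> onorm (hess_y (r i) x y) \<le> 1/10)"
    show "\<exists>x\<in>{1..2}. \<exists>y\<in>feasible (\<lambda>i x y. h i x y + r i x y) x.
        \<not> LICQ (\<lambda>i x y. h i x y + r i x y) x y"
    proof (rule perturbed)
      show "C2_on ({1..2} \<times> UNIV) (\<lambda>(x, y). r i x y)" if "i \<in> {1, 2}" for i
        using r that by blast
      show "\<bar>r i x y\<bar> \<le> 1/10 \<and> norm (grad_y (r i) x y) \<le> 1/10"
        if "i \<in> {1, 2}" "x \<in> {1..2}" "y \<in> cball 0 2" for i x y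
        using conjunct2[OF r, THEN bspec, THEN bspec, THEN bspec, OF that] by blast
    qed
  qed
qed

end
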